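(* Let $(\mu_n)_{n\ge 1}$ be the sequence of discrete pseudo-probability measures associated with a finitely supported family of real coefficients $\{p_k\}_{k\in\Gamma}$ satisfying $\sum_{k\in\Gamma}p_k=1$, as defined in the context. Suppose the $\mu_n$ converge weakly to a finite signed measure $\mu=\lim_{n\to\infty}\mu_n$. Then $\mu$ is the unique solution, up to scaling by a constant, of the dilation equation for signed measures: $\mu$ satisfies $$\mu(A)=\sum_{k\in\Gamma}p_k\,\mu(MA-k)\quad\text{for all Borel sets }A\subset\mathbb{R}^m,$$ and every finite signed Borel measure $\tilde\mu$ on $\mathbb{R}^m$ satisfying this same equation (with $\tilde\mu$ in place of $\mu$) is of the form $\tilde\mu=c\,\mu$ for some $c\in\mathbb{R}$.
   Context: Two cases are treated simultaneously. Either $m=1$, $\Gamma=\mathbb{Z}\subset\mathbb{R}$ and $M$ is multiplication by $2$ on $\mathbb{R}$; or $m=2$, $\Gamma=\mathbb{Z}^2\subset\mathbb{R}^2$, where $\mathbb{R}^2$ is identified with $\mathbb{C}$ (so $\Gamma$ is the Gaussian integers), and $M$ is multiplication by $1+i$. The family $\{p_k\}_{k\in\Gamma}$ consists of real numbers, only finitely many nonzero, with $\sum_{k\in\Gamma}p_k=1$. A pseudo-probability measure is a finite signed Borel measure $\mu$ on $\mathbb{R}^m$ with $\mu(\mathbb{R}^m)=1$. For a set $A$, $MA-k=\{Mx-k:x\in A\}$. Let $\delta_x$ be the unit point mass at $x$, let $D(x)=M^{-1}x$, and let $D_\star$ be the push-forward by $D$ on signed measures. Define $\mu_1=\sum_{k\in\Gamma}p_k\,\delta_{M^{-1}k}$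 and, for $n\ge2$, $\mu_n=\mu_1\star D_\star(\mu_{n-1})$, where $\star$ is convolution. Weak convergence of finite signed measures $\nu_n\to\nu$ means $\int f\,d\nu_n\to\int f\,d\nu$ for every bounded continuous real function $f$ on $\mathbb{R}^m$. *)

theory Defs
  imports "HOL-Analysis.Analysis"
begin

section \<open>Finite signed Borel measures\<close>

text \<open>
  A finite signed Borel measure is a real-valued set function; only its values on Borel sets
  are meaningful, so identities between such functions are stated on \<^term>\<open>sets borel\<close>.
\<close>

definition finite_signed_measure :: "('a::topological_space set \<Rightarrow> real) \<Rightarrow> bool" where
  "finite_signed_measure \<nu> \<longleftrightarrow>
     \<nu> {} = 0 \<and>
     (\<forall>A :: nat \<Rightarrow> 'a set. range A \<subseteq> sets borel \<longrightarrow> disjoint_family A \<longrightarrow>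
        (\<lambda>n. \<nu> (A n)) sums \<nu> (\<Union>n. A n))"

text \<open>
  The Jordan decomposition: the upper variation of \<open>\<nu>\<close> at \<open>A\<close> is the supremum of \<open>\<nu> B\<close> over Borel
  \<open>B \<subseteq> A\<close>. Truncation of negative values by \<^const>\<open>ennreal\<close> is harmless, since \<open>B = {}\<close> is allowed.
\<close>

definition positive_part :: "('a::topological_space set \<Rightarrow> real) \<Rightarrow> 'a measure" where
  "positive_part \<nu> =
     measure_of UNIV (sets borel) (\<lambda>A. SUP B \<in> {B \<in> sets borel. B \<subseteq> A}. ennreal (\<nu> B))"

definition negative_part :: "('a::topological_space set \<Rightarrow> real) \<Rightarrow> 'a measure" where
  "negative_part \<nu> = positive_part (\<lambda>A. - \<nu> A)"

definition signed_integral :: "('a::topological_space set \<Rightarrow> real) \<Rightarrow> ('a \<Rightarrow> real) \<Rightarrow> real" where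
  "signed_integral \<nu> f = integral\<^sup>L (positive_part \<nu>) f - integral\<^sup>L (negative_part \<nu>) f"

definition weakly_converges ::
    "(nat \<Rightarrow> 'a::topological_space set \<Rightarrow> real) \<Rightarrow> ('a set \<Rightarrow> real) \<Rightarrow> bool" where
  "weakly_converges \<nu>s \<nu> \<longleftrightarrow>
     (\<forall>f :: 'a \<Rightarrow> real. continuous_on UNIV f \<longrightarrow> bounded (range f) \<longrightarrow>
        (\<lambda>n. signed_integral (\<nu>s n) f) \<longlonglongrightarrow> signed_integral \<nu> f)"

definition point_mass :: "'a \<Rightarrow> 'a set \<Rightarrow> real" where
  "point_mass x A = indicator A x"

definition push_forward :: "('a \<Rightarrow> 'b) \<Rightarrow> ('a set \<Rightarrow> real) \<Rightarrow> 'b set \<Rightarrow> real" where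
  "push_forward D \<nu> A = \<nu> (D -` A)"

text \<open>
  The convolution is \<open>(\<mu> \<star> \<nu>)(A) = \<integral> \<nu>(A - x) d\<mu>(x)\<close>. The library's convolution is for nonnegative
  measures, and its type class excludes the complex numbers.
\<close>

definition signed_convolution ::
    "('a::real_normed_vector set \<Rightarrow> real) \<Rightarrow> ('a set \<Rightarrow> real) \<Rightarrow> 'a set \<Rightarrow> real" where
  "signed_convolution \<mu> \<nu> A = signed_integral \<mu> (\<lambda>x. \<nu> {y. x + y \<in> A})"


section \<open>The dilation equation\<close>

definition gaussian_integers :: "complex set" where
  "gaussian_integers = {z. Re z \<in> \<int> \<and> Im z \<in> \<int>}"

text \<open>
  A coefficient family indexed by \<open>\<Gamma>\<close> is a function on the ambient space whose values outside \<open>\<Gamma>\<close>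
  are ignored. Sums over \<open>\<Gamma>\<close> range over the support, because \<^const>\<open>sum\<close> is \<open>0\<close> on infinite sets.
\<close>

definition coeff_support :: "'a set \<Rightarrow> ('a \<Rightarrow> real) \<Rightarrow> 'a set" where
  "coeff_support \<Gamma> p = {k \<in> \<Gamma>. p k \<noteq> 0}"

definition dilation_coeffs :: "'a set \<Rightarrow> ('a \<Rightarrow> real) \<Rightarrow> bool" where
  "dilation_coeffs \<Gamma> p \<longleftrightarrow>
     finite (coeff_support \<Gamma> p) \<and> (\<Sum>k \<in> coeff_support \<Gamma> p. p k) = 1"

definition first_measure ::
    "'a set \<Rightarrow> ('a \<Rightarrow> 'a) \<Rightarrow> ('a \<Rightarrow> real) \<Rightarrow> 'a set \<Rightarrow> real" where
  "first_measure \<Gamma> M p A = (\<Sum>k \<in> coeff_support \<Gamma> p. p k * point_mass (inv M k) A)"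

text \<open>The index is shifted by one: \<open>dilation_measure \<Gamma> M p n\<close> is \<open>\<mu>\<^sub>n\<^sub>+\<^sub>1\<close>.\<close>

primrec dilation_measure ::
    "'a::real_normed_vector set \<Rightarrow> ('a \<Rightarrow> 'a) \<Rightarrow> ('a \<Rightarrow> real) \<Rightarrow> nat \<Rightarrow> 'a set \<Rightarrow> real" where
  "dilation_measure \<Gamma> M p 0 = first_measure \<Gamma> M p"
| "dilation_measure \<Gamma> M p (Suc n) =
     signed_convolution (first_measure \<Gamma> M p) (push_forward (inv M) (dilation_measure \<Gamma> M p n))"

definition solves_dilation_equation ::
    "'a::real_normed_vector set \<Rightarrow> ('a \<Rightarrow> 'a) \<Rightarrow> ('a \<Rightarrow> real) \<Rightarrow> ('a set \<Rightarrow> real) \<Rightarrow> bool" where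
  "solves_dilation_equation \<Gamma> M p \<nu> \<longleftrightarrow>
     (\<forall>A \<in> sets borel. \<nu> A = (\<Sum>k \<in> coeff_support \<Gamma> p. p k * \<nu> ((\<lambda>x. M x - k) ` A)))"

end

(* Integrating a bounded continuous f against mu_(n+1) = mu_1 * D mu_n gives
   sum_k p_k \<integral> f ((x + k) / a) d mu_n, where a is 2 or 1 + i; letting n tend to infinity
   shows that the weak limit mu solves the dilation equation. Conversely, a solution nu satisfies
   nu = mu_n * D^n nu for all n, that is, \<integral> f d nu = \<integral> g_n d nu where
   g_n(y) = \<integral> f (x + y / a^n) d mu_n(x). The functionals f |-> \<integral> f d mu_n
   converge pointwise on the Banach space of bounded continuous functions, hence are uniformly bounded, so
   for uniformly continuous f the g_n are uniformly bounded and converge pointwise to the constant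
   \<integral> f d mu. Dominated convergence gives \<integral> f d nu = nu(UNIV) \<integral> f d mu,
   and bounded uniformly continuous functions determine finite signed measures. *)

theory Submission
  imports Defs
begin

section \<open>Jordan decomposition\<close>

lemma finite_signed_measure_empty: "finite_signed_measure \<nu> \<Longrightarrow> \<nu> {} = 0"
  by (simp add: finite_signed_measure_def)

lemma finite_signed_measure_sums:
  fixes A :: "nat \<Rightarrow> 'a::topological_space set"
  assumes "finite_signed_measure \<nu>" "\<And>n. A n \<in> sets borel" "disjoint_family A"
  shows "(\<lambda>n. \<nu> (A n)) sums \<nu> (\<Union>n. A n)"
proof -
  have "range A \<subseteq> sets borel" using assms(2) by auto
  then show ?thesis using assms(1,3) unfolding finite_signed_measure_def by blast
qed

lemma finite_signed_measure_Un:
  assumes "finite_signed_measure \<nu>" "A \<in> sets borel" "B \<in> sets borel" "A \<inter> B = {}"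
  shows "\<nu> (A \<union> B) = \<nu> A + \<nu> B"
proof -
  have "(\<lambda>n. \<nu> (binaryset A B n)) sums \<nu> (\<Union>n. binaryset A B n)"
  proof (rule finite_signed_measure_sums)
    show "disjoint_family (binaryset A B)"
      using assms(4) by (auto simp: disjoint_family_on_def binaryset_def)
  qed (use assms in \<open>auto simp: binaryset_def\<close>)
  moreover have "(\<lambda>n. \<nu> (binaryset A B n)) sums (\<nu> A + \<nu> B)"
    using finite_signed_measure_empty[OF assms(1)] by (rule binaryset_sums)
  ultimately show ?thesis
    unfolding UN_binaryset_eq by (rule sums_unique2)
qed

lemma finite_signed_measure_Diff:
  assumes "finite_signed_measure \<nu>" "A \<in> sets borel" "B \<in> sets borel" "B \<subseteq> A"
  shows "\<nu> (A - B) = \<nu> A - \<nu> B"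
proof -
  have "\<nu> (B \<union> (A - B)) = \<nu> B + \<nu> (A - B)"
    using assms by (intro finite_signed_measure_Un) auto
  moreover have "B \<union> (A - B) = A" using assms(4) by auto
  ultimately show ?thesis by simp
qed

lemma finite_signed_measure_uminus:
  "finite_signed_measure \<nu> \<Longrightarrow> finite_signed_measure (\<lambda>A. - \<nu> A)"
  unfolding finite_signed_measure_def by (simp add: sums_minus)

text \<open>If \<open>\<nu>\<close> is unbounded on the subsets of \<open>E\<close>, then \<open>E\<close> splits into two pieces of large mass
  on one of which \<open>\<nu>\<close> is still unbounded. Iterating removes disjoint pieces of mass at least 1.\<close>

lemma finite_signed_measure_bounded:
  fixes \<nu> :: "'a::topological_space set \<Rightarrow> real"
  assumes \<nu>: "finite_signed_measure \<nu>"
  obtains K where "\<And>A. A \<in> sets borel \<Longrightarrow> \<bar>\<nu> A\<bar> \<le> K"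
proof -
  define U where "U E \<longleftrightarrow> E \<in> sets borel \<and> (\<forall>K. \<exists>B\<in>sets borel. B \<subseteq> E \<and> \<bar>\<nu> B\<bar> > K)" for E
  have U_D: "\<exists>B\<in>sets borel. B \<subseteq> E \<and> \<bar>\<nu> B\<bar> > K" if "U E" for E K
    using that unfolding U_def by blast
  have not_U: "\<exists>K. \<forall>B\<in>sets borel. B \<subseteq> E \<longrightarrow> \<bar>\<nu> B\<bar> \<le> K" if "E \<in> sets borel" "\<not> U E" for E
    using that by (simp add: U_def not_less)
  have split: "\<exists>F. U F \<and> F \<subseteq> E \<and> \<bar>\<nu> (E - F)\<bar> \<ge> 1" if "U E" for E
  proof -
    have E: "E \<in> sets borel" using that unfolding U_def by blast
    \<comment> \<open>The margin \<open>1 + \<bar>\<nu> E\<bar>\<close> gives both \<open>B\<close>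
      and \<open>E - B\<close> mass at least 1 in absolute value, so whichever of them stays
      unbounded, the discarded piece is large.\<close>
    obtain B where B: "B \<in> sets borel" "B \<subseteq> E" "\<bar>\<nu> B\<bar> > 1 + \<bar>\<nu> E\<bar>"
      using U_D[OF \<open>U E\<close>] by metis
    have D: "\<nu> (E - B) = \<nu> E - \<nu> B"
      using finite_signed_measure_Diff[OF \<nu> E B(1,2)] .
    have "U B \<or> U (E - B)"
    proof (rule ccontr)
      assume "\<not> (U B \<or> U (E - B))"
      then have "\<not> U B" "\<not> U (E - B)" by simp_all
      then obtain K L where K: "\<forall>C\<in>sets borel. C \<subseteq> B \<longrightarrow> \<bar>\<nu> C\<bar> \<le> K"
        and L: "\<forall>C\<in>sets borel. C \<subseteq> E - B \<longrightarrow> \<bar>\<nu> C\<bar> \<le> L"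
        using not_U[OF B(1)] not_U[OF sets.Diff[OF E B(1)]] by blast
      obtain C where C: "C \<in> sets borel" "C \<subseteq> E" "\<bar>\<nu> C\<bar> > K + L"
        using U_D[OF \<open>U E\<close>] by metis
      have "\<nu> ((C \<inter> B) \<union> (C - B)) = \<nu> (C \<inter> B) + \<nu> (C - B)"
        using C(1) B(1) by (intro finite_signed_measure_Un[OF \<nu>]) auto
      then have "\<nu> C = \<nu> (C \<inter> B) + \<nu> (C - B)"
        by (simp only: Int_Diff_Un)
      moreover have "\<bar>\<nu> (C \<inter> B)\<bar> \<le> K" by (rule K[rule_format]) (use C(1) B(1) in auto)
      moreover have "\<bar>\<nu> (C - B)\<bar> \<le> L" by (rule L[rule_format]) (use C(1,2) B(1) in auto)
      ultimately show False using C(3) by linarith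
    qed
    moreover have "\<bar>\<nu> (E - B)\<bar> \<ge> 1" using B(3) D by linarith
    moreover have "\<bar>\<nu> (E - (E - B))\<bar> \<ge> 1"
      using B(3) unfolding double_diff[OF B(2) subset_refl] by linarith
    ultimately show ?thesis using B(2) Diff_subset by metis
  qed
  show thesis
  proof (cases "U UNIV")
    case False
    then obtain K where "\<forall>B\<in>sets borel. \<bar>\<nu> B\<bar> \<le> K"
      using not_U[of UNIV] by auto
    then show thesis by (intro that[of K]) blast
  next
    case True
    have "\<exists>F. \<forall>n. U (F n) \<and> (F (Suc n) \<subseteq> F n \<and> \<bar>\<nu> (F n - F (Suc n))\<bar> \<ge> 1)"
    proof (rule dependent_nat_choice)
      show "\<exists>F. U F" using True by blast
    next
      fix E assume "U E"
      then show "\<exists>F. U F \<and> F \<subseteq> E \<and> \<bar>\<nu> (E - F)\<bar> \<ge> 1" by (rule split)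
    qed
    then obtain F where F: "\<And>n. U (F n)" "\<And>n. F (Suc n) \<subseteq> F n"
        "\<And>n. \<bar>\<nu> (F n - F (Suc n))\<bar> \<ge> 1"
      by blast
    have dec: "F n \<subseteq> F m" if "m \<le> n" for m n
      using F(2) that by (rule lift_Suc_antimono_le)
    have "disjoint_family (\<lambda>n. F n - F (Suc n))"
      unfolding disjoint_family_on_def
    proof (intro ballI impI)
      fix m n :: nat assume "m \<noteq> n"
      then show "(F m - F (Suc m)) \<inter> (F n - F (Suc n)) = {}"
        using dec[of "Suc m" n] dec[of "Suc n" m] by (cases "m < n") auto
    qed
    moreover have "F n - F (Suc n) \<in> sets borel" for n
      using F(1) unfolding U_def by (intro sets.Diff) blast+
    \<comment> \<open>Countable additivity makes the masses of the removed pieces a convergent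
      series, yet none of its terms is below 1 in absolute value.\<close>
    ultimately have "summable (\<lambda>n. \<nu> (F n - F (Suc n)))"
      by (intro sums_summable[OF finite_signed_measure_sums[OF \<nu>]])
    then have "(\<lambda>n. \<nu> (F n - F (Suc n))) \<longlonglongrightarrow> 0" by (rule summable_LIMSEQ_zero)
    then obtain n where "\<bar>\<nu> (F n - F (Suc n))\<bar> < 1"
      using LIMSEQ_D[of "\<lambda>n. \<nu> (F n - F (Suc n))" 0 1] by auto
    then show thesis using F(3)[of n] by simp
  qed
qed

section \<open>The variations as finite measures, and the Jordan decomposition\<close>

lemma space_positive_part [simp]: "space (positive_part \<nu>) = UNIV"
  and sets_positive_part [simp]: "sets (positive_part \<nu>) = sets borel"
proof -
  have "sigma_algebra UNIV (sets (borel :: 'a measure))"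
    using sets.sigma_algebra_axioms[of "borel :: 'a measure"] by simp
  then show "space (positive_part \<nu>) = UNIV" "sets (positive_part \<nu>) = sets borel"
    by (simp_all add: positive_part_def sigma_algebra.sigma_sets_eq)
qed

lemma space_negative_part [simp]: "space (negative_part \<nu>) = UNIV"
  and sets_negative_part [simp]: "sets (negative_part \<nu>) = sets borel"
  by (simp_all add: negative_part_def)

lemma measurable_positive_part [simp]: "measurable (positive_part \<nu>) N = measurable borel N"
  and measurable_negative_part [simp]: "measurable (negative_part \<nu>) N = measurable borel N"
  by (simp_all cong: measurable_cong_sets)

text \<open>\<open>measure_of\<close> returns the given set function only if it is countably
  additive. Superadditivity of the supremum on disjoint sets gives one inequality; cutting a Borel
  subset of the union along the pieces gives the other.\<close>

lemma emeasure_positive_part: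
  fixes \<nu> :: "'a::topological_space set \<Rightarrow> real"
  assumes \<nu>: "finite_signed_measure \<nu>" and A: "A \<in> sets borel"
  shows "emeasure (positive_part \<nu>) A = (SUP B \<in> {B \<in> sets borel. B \<subseteq> A}. ennreal (\<nu> B))"
proof -
  define m where "m A = (SUP B \<in> {B \<in> sets borel. B \<subseteq> A}. ennreal (\<nu> B))" for A
  have m_ub: "ennreal (\<nu> B) \<le> m A" if "B \<in> sets borel" "B \<subseteq> A" for A B
    unfolding m_def using that by (intro SUP_upper) auto
  have m_mono: "m A \<le> m B" if "A \<subseteq> B" for A B
    unfolding m_def using that by (intro SUP_subset_mono) auto
  have m_add: "m X + m Y \<le> m (X \<union> Y)" if "X \<inter> Y = {}" for X Y
  proof -
    have ne: "{B \<in> sets borel. B \<subseteq> Z} \<noteq> {}" for Z :: "'a set"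
      by auto
    \<comment> \<open>\<open>ennreal\<close> truncates negative masses, which spoils additivity; a
      set of negative mass is traded for the empty set, which has the same truncated mass.\<close>
    have pos: "\<exists>B'\<in>sets borel. B' \<subseteq> B \<and> 0 \<le> \<nu> B' \<and> ennreal (\<nu> B) = ennreal (\<nu> B')"
      if "B \<in> sets borel" for B
    proof (cases "0 \<le> \<nu> B")
      case True
      then show ?thesis using that by blast
    next
      case False
      then show ?thesis using finite_signed_measure_empty[OF \<nu>]
        by (intro bexI[of _ "{}"]) (auto simp: ennreal_neg)
    qed
    have "ennreal (\<nu> B) + ennreal (\<nu> C) \<le> m (X \<union> Y)"
      if BC: "B \<in> sets borel" "B \<subseteq> X" "C \<in> sets borel" "C \<subseteq> Y" for B C
    proof -
      obtain B' C' where *: "B' \<in> sets borel" "B' \<subseteq> B" "0 \<le> \<nu> B'" "ennreal (\<nu> B) = ennreal (\<nu> B')"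
        "C' \<in> sets borel" "C' \<subseteq> C" "0 \<le> \<nu> C'" "ennreal (\<nu> C) = ennreal (\<nu> C')"
        using pos[OF BC(1)] pos[OF BC(3)] by blast
      have "B' \<inter> C' = {}" using BC(2,4) *(2,6) \<open>X \<inter> Y = {}\<close> by blast
      then have "\<nu> (B' \<union> C') = \<nu> B' + \<nu> C'"
        using *(1,5) by (intro finite_signed_measure_Un[OF \<nu>])
      moreover have "ennreal (\<nu> (B' \<union> C')) \<le> m (X \<union> Y)"
        using BC(2,4) *(1,2,5,6) by (intro m_ub) auto
      ultimately show ?thesis
        unfolding *(4,8) using *(3,7) by simp
    qed
    then have "ennreal (\<nu> B) + m Y \<le> m (X \<union> Y)" if "B \<in> sets borel" "B \<subseteq> X" for B
      unfolding m_def[of Y] ennreal_SUP_add_right[OF ne]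
      using that by (intro SUP_least) auto
    then show ?thesis
      unfolding m_def[of X] ennreal_SUP_add_left[OF ne, symmetric]
      by (intro SUP_least) auto
  qed
  have "countably_additive (sets borel) m"
  proof (rule countably_additiveI)
    fix A :: "nat \<Rightarrow> 'a set"
    assume A: "range A \<subseteq> sets borel" "disjoint_family A" and "(\<Union>i. A i) \<in> sets borel"
    then have Ai: "A i \<in> sets borel" for i by auto
    have "(\<Sum>i<n. m (A i)) \<le> m (\<Union>i<n. A i)" for n
    proof (induction n)
      case (Suc n)
      have "A i \<inter> A n = {}" if "i < n" for i
        using disjoint_family_onD[OF A(2), of i n] that by simp
      then have "(\<Union>i<n. A i) \<inter> A n = {}" by blast
      from m_add[OF this] have "m (\<Union>i<n. A i) + m (A n) \<le> m (\<Union>i<Suc n. A i)"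
        by (simp add: lessThan_Suc Un_commute)
      with Suc show ?case
        by (auto intro: order_trans[OF add_right_mono])
    qed (simp add: m_def)
    also have "m (\<Union>i<n. A i) \<le> m (\<Union>i. A i)" for n
      by (rule m_mono) auto
    finally have le: "(\<Sum>i. m (A i)) \<le> m (\<Union>i. A i)"
      by (intro suminf_le_const) auto
    have "ennreal (\<nu> B) \<le> (\<Sum>i. m (A i))" if B: "B \<in> sets borel" "B \<subseteq> (\<Union>i. A i)" for B
    proof -
      have "(\<lambda>i. \<nu> (B \<inter> A i)) sums \<nu> (\<Union>i. B \<inter> A i)"
        using B(1) Ai disjoint_family_on_bisimulation[OF A(2), of "\<lambda>i. B \<inter> A i"]
        by (intro finite_signed_measure_sums[OF \<nu>]) auto
      then have "(\<lambda>n. \<Sum>i<n. \<nu> (B \<inter> A i)) \<longlonglongrightarrow> \<nu> B"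
        using B(2) unfolding sums_def Int_UN_distrib[symmetric] by (simp only: Int_absorb2)
      then have "(\<lambda>n. ennreal (\<Sum>i<n. \<nu> (B \<inter> A i))) \<longlonglongrightarrow> ennreal (\<nu> B)"
        by (rule tendsto_ennrealI)
      moreover have "ennreal (\<Sum>i<n. \<nu> (B \<inter> A i)) \<le> (\<Sum>i. m (A i))" for n
      proof -
        \<comment> \<open>The terms are replaced by their positive parts first, because
          \<open>ennreal\<close> commutes with sums of nonnegative terms.\<close>
        have "ennreal (\<Sum>i<n. \<nu> (B \<inter> A i)) \<le> ennreal (\<Sum>i<n. max 0 (\<nu> (B \<inter> A i)))"
          by (intro ennreal_leI sum_mono) simp
        also have "\<dots> = (\<Sum>i<n. ennreal (max 0 (\<nu> (B \<inter> A i))))"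
          by (rule sum_ennreal[symmetric]) simp
        also have "\<dots> = (\<Sum>i<n. ennreal (\<nu> (B \<inter> A i)))"
          by (intro sum.cong refl) (simp add: max_def ennreal_neg)
        also have "\<dots> \<le> (\<Sum>i<n. m (A i))"
          using B Ai by (intro sum_mono m_ub) auto
        also have "\<dots> \<le> (\<Sum>i. m (A i))"
          by (rule sum_le_suminf) auto
        finally show ?thesis .
      qed
      ultimately show ?thesis by (intro LIMSEQ_le_const2) auto
    qed
    then have "m (\<Union>i. A i) \<le> (\<Sum>i. m (A i))"
      unfolding m_def[of "\<Union>i. A i"] by (intro SUP_least) auto
    with le show "(\<Sum>i. m (A i)) = m (\<Union>i. A i)" by (rule antisym)
  qed
  moreover have "positive (sets borel) m"
    using finite_signed_measure_empty[OF \<nu>] by (auto simp: positive_def m_def)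
  ultimately show ?thesis
    using A sets.sigma_algebra_axioms[of "borel :: 'a measure"]
    unfolding positive_part_def m_def by (intro emeasure_measure_of_sigma) auto
qed

text \<open>Boundedness of \<nu> makes the real supremum meaningful, and the empty set as a
  competitor makes it nonnegative, so truncation has no effect on it.\<close>

lemma emeasure_positive_part_eq:
  assumes \<nu>: "finite_signed_measure \<nu>" and A: "A \<in> sets borel"
  shows "emeasure (positive_part \<nu>) A = ennreal (SUP B \<in> {B \<in> sets borel. B \<subseteq> A}. \<nu> B)"
    and "bdd_above (\<nu> ` {B \<in> sets borel. B \<subseteq> A})"
    and "0 \<le> (SUP B \<in> {B \<in> sets borel. B \<subseteq> A}. \<nu> B)"
proof -
  obtain K where K: "\<And>A. A \<in> sets borel \<Longrightarrow> \<bar>\<nu> A\<bar> \<le> K"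
    using finite_signed_measure_bounded[OF \<nu>] by blast
  show bdd: "bdd_above (\<nu> ` {B \<in> sets borel. B \<subseteq> A})"
    using K by (intro bdd_aboveI2[of _ _ K]) (simp add: abs_le_iff)
  let ?s = "SUP B \<in> {B \<in> sets borel. B \<subseteq> A}. \<nu> B"
  show nonneg: "0 \<le> ?s"
    using cSUP_upper[OF _ bdd, of "{}"] finite_signed_measure_empty[OF \<nu>] by simp
  show "emeasure (positive_part \<nu>) A = ennreal ?s"
    unfolding emeasure_positive_part[OF assms]
  proof (rule antisym)
    show "(SUP B \<in> {B \<in> sets borel. B \<subseteq> A}. ennreal (\<nu> B)) \<le> ennreal ?s"
      by (intro SUP_least ennreal_leI cSUP_upper bdd)
    show "ennreal ?s \<le> (SUP B \<in> {B \<in> sets borel. B \<subseteq> A}. ennreal (\<nu> B))" (is "_ \<le> ?e")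
    proof (cases "?e = top")
      case True
      then show ?thesis by (simp only: top_greatest)
    next
      case False
      then obtain r where r: "0 \<le> r" "?e = ennreal r"
        by (cases ?e) auto
      have "\<nu> B \<le> r" if "B \<in> sets borel" "B \<subseteq> A" for B
      proof -
        have "ennreal (\<nu> B) \<le> ennreal r"
          unfolding r(2)[symmetric] using that by (intro SUP_upper) auto
        then show ?thesis using r(1) by (auto simp: ennreal_le_iff2)
      qed
      then have "?s \<le> r" by (intro cSUP_least) auto
      then show ?thesis unfolding r(2) by (rule ennreal_leI)
    qed
  qed
qed

lemma finite_measure_positive_part:
  "finite_signed_measure \<nu> \<Longrightarrow> finite_measure (positive_part \<nu>)"
  by (intro finite_measureI) (simp add: emeasure_positive_part_eq)

lemma finite_measure_negative_part:
  "finite_signed_measure \<nu> \<Longrightarrow> finite_measure (negative_part \<nu>)"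
  unfolding negative_part_def
  by (intro finite_measure_positive_part finite_signed_measure_uminus)

text \<open>Complementation inside \<open>A\<close> replaces a Hahn decomposition: passing from
  \<open>B\<close> to \<open>A - B\<close> turns \<nu> B into \<nu> A - \<nu> B, so the suprema of
  \<nu> and of - \<nu> over the Borel subsets of \<open>A\<close> differ by exactly \<nu> A.\<close>

lemma signed_measure_eq_parts:
  assumes \<nu>: "finite_signed_measure \<nu>" and A: "A \<in> sets borel"
  shows "\<nu> A = measure (positive_part \<nu>) A - measure (negative_part \<nu>) A"
proof -
  let ?S = "{B \<in> sets borel. B \<subseteq> A}"
  note \<nu>' = finite_signed_measure_uminus[OF \<nu>]
  have p: "measure (positive_part \<nu>) A = (SUP B \<in> ?S. \<nu> B)"
    using emeasure_positive_part_eq[OF \<nu> A] by (simp add: measure_def)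
  have n: "measure (negative_part \<nu>) A = (SUP B \<in> ?S. - \<nu> B)"
    using emeasure_positive_part_eq[OF \<nu>' A] by (simp add: measure_def negative_part_def)
  have "(SUP B \<in> ?S. \<nu> B) \<le> \<nu> A + (SUP B \<in> ?S. - \<nu> B)"
  proof (rule cSUP_least)
    fix B assume B: "B \<in> ?S"
    have "- \<nu> (A - B) \<le> (SUP B \<in> ?S. - \<nu> B)"
      using A B by (intro cSUP_upper emeasure_positive_part_eq(2)[OF \<nu>']) auto
    then show "\<nu> B \<le> \<nu> A + (SUP B \<in> ?S. - \<nu> B)"
      using finite_signed_measure_Diff[OF \<nu> A, of B] B by simp
  qed auto
  moreover have "(SUP B \<in> ?S. - \<nu> B) \<le> (SUP B \<in> ?S. \<nu> B) - \<nu> A"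
  proof (rule cSUP_least)
    fix B assume B: "B \<in> ?S"
    have "\<nu> (A - B) \<le> (SUP B \<in> ?S. \<nu> B)"
      using A B by (intro cSUP_upper emeasure_positive_part_eq(2)[OF \<nu>]) auto
    then show "- \<nu> B \<le> (SUP B \<in> ?S. \<nu> B) - \<nu> A"
      using finite_signed_measure_Diff[OF \<nu> A, of B] B by simp
  qed auto
  ultimately show ?thesis unfolding p n by simp
qed

section \<open>Integrals of bounded Borel functions\<close>

text \<open>A class closed under pointwise limits with a common bound, whose members are integrable
  against both parts of any finite signed measure.\<close>

definition bounded_borel :: "('a::topological_space \<Rightarrow> real) \<Rightarrow> bool" where
  "bounded_borel f \<longleftrightarrow> f \<in> borel_measurable borel \<and> (\<exists>B. \<forall>x. \<bar>f x\<bar> \<le> B)"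

lemma bounded_borelI: "f \<in> borel_measurable borel \<Longrightarrow> (\<And>x. \<bar>f x\<bar> \<le> B) \<Longrightarrow> bounded_borel f"
  unfolding bounded_borel_def by blast

lemma bounded_borel_measurable: "bounded_borel f \<Longrightarrow> f \<in> borel_measurable borel"
  by (simp add: bounded_borel_def)

lemma bounded_borel_const: "bounded_borel (\<lambda>x. c)"
  by (rule bounded_borelI[of _ "\<bar>c\<bar>"]) auto

lemma bounded_borel_indicator: "A \<in> sets borel \<Longrightarrow> bounded_borel (indicator A)"
  by (rule bounded_borelI[of _ 1]) (auto simp: indicator_def)

lemma bounded_borel_cmult: "bounded_borel f \<Longrightarrow> bounded_borel (\<lambda>x. c * f x)"
  unfolding bounded_borel_def abs_mult
  by (auto intro!: borel_measurable_times exI[of _ "\<bar>c\<bar> * _"] mult_left_mono)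

lemma bounded_borel_compose:
  "bounded_borel f \<Longrightarrow> h \<in> borel_measurable borel \<Longrightarrow> bounded_borel (\<lambda>x. f (h x))"
  unfolding bounded_borel_def by (auto intro: measurable_compose)

lemma bounded_borel_continuous:
  "continuous_on UNIV f \<Longrightarrow> bounded (range f) \<Longrightarrow> bounded_borel f"
  unfolding bounded_borel_def bounded_iff by (auto intro: borel_measurable_continuous_onI)

lemma bounded_borel_limit:
  fixes f :: "nat \<Rightarrow> 'a::topological_space \<Rightarrow> real"
  assumes "\<And>i. f i \<in> borel_measurable borel" "\<And>i x. \<bar>f i x\<bar> \<le> B"
    and lim: "\<And>x. (\<lambda>i. f i x) \<longlonglongrightarrow> g x"
  shows "bounded_borel g"
proof (rule bounded_borelI)
  show "g \<in> borel_measurable borel"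
    using assms by (intro borel_measurable_LIMSEQ_real[OF lim]) auto
  show "\<bar>g x\<bar> \<le> B" for x
    using assms(2) by (intro LIMSEQ_le_const2[OF tendsto_rabs[OF lim]]) auto
qed

text \<open>Reduces identities between signed integrals to indicators. Induction over nonnegative
  Borel functions is applied to the positive and negative parts of \<open>f\<close>; the common
  bound in the limit case is there for dominated convergence.\<close>

lemma bounded_borel_induct [consumes 1, case_names indicator cmult add limit]:
  fixes f :: "'a::topological_space \<Rightarrow> real"
  assumes f: "bounded_borel f"
    and indicator: "\<And>A. A \<in> sets borel \<Longrightarrow> P (indicator A)"
    and cmult: "\<And>c u. bounded_borel u \<Longrightarrow> P u \<Longrightarrow> P (\<lambda>x. c * u x)"
    and add: "\<And>u v. bounded_borel u \<Longrightarrow> bounded_borel v \<Longrightarrow> P u \<Longrightarrow> P v \<Longrightarrow> P (\<lambda>x. u x + v x)"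
    and limit: "\<And>U u B. (\<And>i. U i \<in> borel_measurable borel) \<Longrightarrow> (\<And>i x. \<bar>U i x\<bar> \<le> B) \<Longrightarrow>
      (\<And>x. (\<lambda>i. U i x) \<longlonglongrightarrow> u x) \<Longrightarrow> (\<And>i. P (U i)) \<Longrightarrow> P u"
  shows "P f"
proof -
  \<comment> \<open>Boundedness is a premise inside the induction claim, since the induction runs
    over all nonnegative Borel functions; approximations from below inherit the bound of their
    limit.\<close>
  have nonneg: "(\<exists>B. \<forall>x. u x \<le> B) \<longrightarrow> P u" if "u \<in> borel_measurable borel" "\<And>x. 0 \<le> u x" for u
    using that
  proof (induction rule: borel_measurable_induct_real)
    case (set A)
    then show ?case using indicator by blast
  next
    case (mult u c)
    show ?case
    proof (cases "c = 0")
      \<comment> \<open>Here \<open>u\<close> may be unbounded and the induction hypothesis void, so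
        the zero function is obtained from the indicator of the empty set.\<close>
      case True
      then have "(\<lambda>x. c * u x) = (\<lambda>x. 0 * indicator {} x)" by auto
      then show ?thesis
        using cmult[OF bounded_borel_indicator, of "{}" 0] indicator[of "{}"] by simp
    next
      case False
      show ?thesis
      proof
        assume "\<exists>B. \<forall>x. c * u x \<le> B"
        then obtain B where "\<And>x. c * u x \<le> B" by blast
        then have le: "u x \<le> B / c" for x
          using mult(1) False by (simp add: pos_le_divide_eq mult.commute)
        then have "bounded_borel u"
          using mult by (intro bounded_borelI[of _ "B / c"]) auto
        then show "P (\<lambda>x. c * u x)" using mult le by (intro cmult) blast+
      qed
    qed
  next
    case (add u v)
    show ?case
    proof
      assume "\<exists>B. \<forall>x. v x + u x \<le> B"
      then obtain B where B: "\<And>x. v x + u x \<le> B" by blast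
      have u: "u x \<le> B" and v: "v x \<le> B" for x
        using B[of x] add(2)[of x] add(4)[of x] by simp_all
      have "bounded_borel u" "bounded_borel v"
        using u v add by (intro bounded_borelI[of _ B]; simp)+
      then show "P (\<lambda>x. v x + u x)"
        using u v add by (intro assms(4)) blast+
    qed
  next
    case (seq U)
    show ?case
    proof
      assume "\<exists>B. \<forall>x. u x \<le> B"
      then obtain B where B: "\<And>x. u x \<le> B" by blast
      have lim: "(\<lambda>i. U i x) \<longlonglongrightarrow> u x" for x using seq by simp
      have le: "U i x \<le> B" for i x
      proof -
        have "U i x \<le> u x"
          using seq(3) by (intro incseq_le lim) (auto simp: incseq_def le_fun_def)
        then show ?thesis using B[of x] by linarith
      qed
      show "P u"
      proof (rule limit[where B = B])
        show "(\<lambda>i. U i x) \<longlonglongrightarrow> u x" for x by (rule lim)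
        show "\<bar>U i x\<bar> \<le> B" for i x using le seq(2) by simp
        show "P (U i)" for i using seq(5) le by blast
      qed (rule seq(1))
    qed
  qed
  obtain B where B: "\<And>x. \<bar>f x\<bar> \<le> B" and [measurable]: "f \<in> borel_measurable borel"
    using f unfolding bounded_borel_def by blast
  have B0: "0 \<le> B" using B[of undefined] by linarith
  have "bounded_borel (\<lambda>x. max 0 (f x))" "bounded_borel (\<lambda>x. max 0 (- f x))"
    using B B0 by (intro bounded_borelI[of _ B]; auto simp: abs_le_iff)+
  moreover have "P (\<lambda>x. max 0 (f x))" "P (\<lambda>x. max 0 (- f x))"
    using B B0 by (intro nonneg[rule_format]; auto simp: abs_le_iff intro!: exI[of _ B])+
  ultimately have "P (\<lambda>x. max 0 (f x) + (-1) * max 0 (- f x))"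
    by (intro add cmult bounded_borel_cmult)
  also have "(\<lambda>x. max 0 (f x) + (-1) * max 0 (- f x)) = f"
    by (auto simp: max_def)
  finally show ?thesis .
qed

section \<open>Linearity, limits and bounds of the signed integral\<close>

lemma integrable_parts:
  fixes f :: "'a::topological_space \<Rightarrow> real"
  assumes "finite_signed_measure \<nu>" "bounded_borel f"
  shows "integrable (positive_part \<nu>) f" "integrable (negative_part \<nu>) f"
proof -
  obtain B where "\<And>x. \<bar>f x\<bar> \<le> B" "f \<in> borel_measurable borel"
    using assms(2) unfolding bounded_borel_def by blast
  then show "integrable (positive_part \<nu>) f" "integrable (negative_part \<nu>) f"
    using finite_measure_positive_part[OF assms(1)] finite_measure_negative_part[OF assms(1)]
    by (intro finite_measure.integrable_const_bound[of _ _ B]; simp)+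
qed

lemma signed_integral_indicator:
  "finite_signed_measure \<nu> \<Longrightarrow> A \<in> sets borel \<Longrightarrow> signed_integral \<nu> (indicator A) = \<nu> A"
  by (simp add: signed_integral_def signed_measure_eq_parts)

lemma signed_integral_cmult: "signed_integral \<nu> (\<lambda>x. c * f x) = c * signed_integral \<nu> f"
  by (simp add: signed_integral_def right_diff_distrib)

lemma signed_integral_add:
  "finite_signed_measure \<nu> \<Longrightarrow> bounded_borel f \<Longrightarrow> bounded_borel g \<Longrightarrow>
    signed_integral \<nu> (\<lambda>x. f x + g x) = signed_integral \<nu> f + signed_integral \<nu> g"
  by (simp add: signed_integral_def integrable_parts)

lemma signed_integral_sum:
  "finite_signed_measure \<nu> \<Longrightarrow> (\<And>k. k \<in> S \<Longrightarrow> bounded_borel (f k)) \<Longrightarrow>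
    signed_integral \<nu> (\<lambda>x. \<Sum>k\<in>S. f k x) = (\<Sum>k\<in>S. signed_integral \<nu> (f k))"
  by (simp add: signed_integral_def integrable_parts sum_subtractf)

lemma signed_integral_diff:
  "finite_signed_measure \<nu> \<Longrightarrow> bounded_borel f \<Longrightarrow> bounded_borel g \<Longrightarrow>
    signed_integral \<nu> (\<lambda>x. f x - g x) = signed_integral \<nu> f - signed_integral \<nu> g"
  by (simp add: signed_integral_def integrable_parts)

lemma signed_integral_const:
  assumes "finite_signed_measure \<nu>"
  shows "signed_integral \<nu> (\<lambda>x. c) = c * \<nu> UNIV"
  using signed_integral_indicator[OF assms, of UNIV] signed_integral_cmult[of \<nu> c "indicator UNIV"]
  by simp

text \<open>Dominated convergence for each Jordan part; the constant majorant is integrable because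
  both parts are finite.\<close>

lemma signed_integral_limit:
  assumes \<nu>: "finite_signed_measure \<nu>"
    and f: "\<And>i. f i \<in> borel_measurable borel" and B: "\<And>i x. \<bar>f i x\<bar> \<le> B"
    and lim: "\<And>x. (\<lambda>i. f i x) \<longlonglongrightarrow> g x"
  shows "(\<lambda>i. signed_integral \<nu> (f i)) \<longlonglongrightarrow> signed_integral \<nu> g"
proof -
  have g: "g \<in> borel_measurable borel"
    using bounded_borel_limit[OF f B lim] by (rule bounded_borel_measurable)
  show ?thesis
    unfolding signed_integral_def
    using f B lim g integrable_parts[OF \<nu> bounded_borel_const[of B]]
    by (intro tendsto_diff integral_dominated_convergence[where w = "\<lambda>_. B"]) auto
qed

text \<open>The constant is the total variation, the sum of the masses of the two parts. It is
  independent of \<open>f\<close> and \<open>B\<close>, so integration is a bounded functional for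
  the sup norm.\<close>

lemma signed_integral_bound:
  fixes \<nu> :: "'a::topological_space set \<Rightarrow> real"
  assumes "finite_signed_measure \<nu>"
  obtains C where "\<And>f B. f \<in> borel_measurable borel \<Longrightarrow> (\<And>x. \<bar>f x\<bar> \<le> B) \<Longrightarrow> \<bar>signed_integral \<nu> f\<bar> \<le> B * C"
proof
  fix f :: "'a \<Rightarrow> real" and B
  assume f: "f \<in> borel_measurable borel" and B: "\<And>x. \<bar>f x\<bar> \<le> B"
  let ?P = "positive_part \<nu>" and ?N = "negative_part \<nu>"
  have bb: "bounded_borel f" using f B by (rule bounded_borelI)
  have "\<bar>integral\<^sup>L M f\<bar> \<le> integral\<^sup>L M (\<lambda>x. B)"
    if "integrable M f" "integrable M (\<lambda>x. B)" for M
    using order_trans[OF integral_abs_bound integral_mono[OF integrable_abs[OF that(1)] that(2)]] B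
    by blast
  from this[OF integrable_parts(1) integrable_parts(1)] this[OF integrable_parts(2) integrable_parts(2)]
  have "\<bar>integral\<^sup>L ?P f\<bar> \<le> integral\<^sup>L ?P (\<lambda>x. B)" "\<bar>integral\<^sup>L ?N f\<bar> \<le> integral\<^sup>L ?N (\<lambda>x. B)"
    using assms bb bounded_borel_const[of B] by blast+
  then show "\<bar>signed_integral \<nu> f\<bar> \<le> B * (measure ?P UNIV + measure ?N UNIV)"
    unfolding signed_integral_def by (simp add: algebra_simps)
qed

text \<open>Because of cancellation, the Jordan parts of \<nu>' need not be combinations of images
  of the parts of \<nu>, so the formula is built up from indicators. It serves the first measure,
  the recursion, the solutions and the weak limit alike.\<close>

lemma signed_integral_lincomb_push_forward:
  fixes \<nu> :: "'a::topological_space set \<Rightarrow> real" and \<nu>' :: "'b::topological_space set \<Rightarrow> real"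
  assumes \<nu>: "finite_signed_measure \<nu>" and \<nu>': "finite_signed_measure \<nu>'"
    and h: "\<And>k. k \<in> S \<Longrightarrow> h k \<in> borel_measurable borel"
    and eq: "\<And>A. A \<in> sets borel \<Longrightarrow> \<nu>' A = (\<Sum>k\<in>S. p k * \<nu> (h k -` A))"
    and f: "bounded_borel f"
  shows "signed_integral \<nu>' f = (\<Sum>k\<in>S. p k * signed_integral \<nu> (\<lambda>x. f (h k x)))"
  using f
proof (induction rule: bounded_borel_induct)
  case (indicator A)
  have "signed_integral \<nu> (\<lambda>x. indicator A (h k x)) = \<nu> (h k -` A)" if "k \<in> S" for k
  proof -
    have "h k -` A \<in> sets borel"
      using measurable_sets[OF h[OF that] indicator] by simp
    moreover have "(\<lambda>x. indicator A (h k x)) = (indicator (h k -` A) :: 'a \<Rightarrow> real)"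
      by (auto simp: indicator_def)
    ultimately show ?thesis using signed_integral_indicator[OF \<nu>] by simp
  qed
  then show ?case
    using indicator by (simp add: signed_integral_indicator[OF \<nu>'] eq)
next
  case (cmult c u)
  then show ?case by (simp add: signed_integral_cmult sum_distrib_left mult.left_commute)
next
  case (add u v)
  then show ?case
    using h by (simp add: signed_integral_add \<nu> \<nu>' bounded_borel_compose distrib_left sum.distrib)
next
  case (limit U u B)
  have "(\<lambda>i. \<Sum>k\<in>S. p k * signed_integral \<nu> (\<lambda>x. U i (h k x)))
      \<longlonglongrightarrow> (\<Sum>k\<in>S. p k * signed_integral \<nu> (\<lambda>x. u (h k x)))"
    using h limit(1-3) measurable_compose
    by (intro tendsto_sum tendsto_mult tendsto_const signed_integral_limit[OF \<nu>]) blast+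
  then show ?case
    using signed_integral_limit[OF \<nu>' limit(1-3)] limit(4) LIMSEQ_unique by simp
qed

section \<open>Constructing and comparing finite signed measures\<close>

lemma finite_signed_measure_cong:
  fixes \<nu> :: "'a::topological_space set \<Rightarrow> real"
  assumes "finite_signed_measure \<nu>" "\<And>A. A \<in> sets borel \<Longrightarrow> \<nu>' A = \<nu> A"
  shows "finite_signed_measure \<nu>'"
  unfolding finite_signed_measure_def
proof (intro conjI allI impI)
  show "\<nu>' {} = 0" using assms by (simp add: finite_signed_measure_empty)
  fix A :: "nat \<Rightarrow> 'a set" assume A: "range A \<subseteq> sets borel" "disjoint_family A"
  then have "A n \<in> sets borel" for n by auto
  then show "(\<lambda>n. \<nu>' (A n)) sums \<nu>' (\<Union>n. A n)"
    using finite_signed_measure_sums[OF assms(1) _ A(2)] assms(2) by (simp add: sets.countable_UN')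
qed

lemma finite_signed_measure_lincomb_push_forward:
  fixes \<nu> :: "'a::topological_space set \<Rightarrow> real"
  assumes \<nu>: "finite_signed_measure \<nu>" and h: "\<And>k. k \<in> S \<Longrightarrow> h k \<in> borel_measurable borel"
  shows "finite_signed_measure (\<lambda>A :: 'b::topological_space set. \<Sum>k\<in>S. p k * \<nu> (h k -` A))"
  unfolding finite_signed_measure_def
proof (intro conjI allI impI)
  show "(\<Sum>k\<in>S. p k * \<nu> (h k -` {})) = 0" by (simp add: finite_signed_measure_empty[OF \<nu>])
  fix A :: "nat \<Rightarrow> 'b set" assume A: "range A \<subseteq> sets borel" "disjoint_family A"
  have "(\<lambda>n. \<nu> (h k -` A n)) sums \<nu> (\<Union>n. h k -` A n)" if "k \<in> S" for k
  proof (rule finite_signed_measure_sums[OF \<nu>])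
    show "h k -` A n \<in> sets borel" for n
      using measurable_sets[OF h[OF that], of "A n"] A(1) by auto
    show "disjoint_family (\<lambda>n. h k -` A n)"
      using A(2) by (fastforce simp: disjoint_family_on_def)
  qed
  then show "(\<lambda>n. \<Sum>k\<in>S. p k * \<nu> (h k -` A n)) sums (\<Sum>k\<in>S. p k * \<nu> (h k -` (\<Union>n. A n)))"
    unfolding vimage_UN by (intro sums_sum sums_mult)
qed

lemma finite_signed_measure_point_mass:
  "finite_signed_measure (point_mass (x :: 'a::topological_space))"
  unfolding finite_signed_measure_def point_mass_def
proof (intro conjI allI impI)
  fix A :: "nat \<Rightarrow> 'a set" assume A: "disjoint_family A"
  show "(\<lambda>n. indicator (A n) x) sums (indicator (\<Union>n. A n) x :: real)"
  proof (cases "x \<in> (\<Union>n. A n)")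
    case True
    then obtain m where m: "x \<in> A m" by blast
    then have "indicator (A n) x = (if n = m then 1 else 0 :: real)" for n
      using disjoint_family_onD[OF A, of n m] by (auto simp: indicator_def)
    then show ?thesis using True sums_single[of m "\<lambda>_. 1 :: real"] by simp
  qed (simp add: indicator_def)
qed simp

text \<open>The indicator of a closed set \<open>F\<close> is the pointwise limit of \<open>max 0 (1 - n * dist x F)\<close>.\<close>

lemma finite_signed_measure_eqI:
  fixes \<mu> \<nu> :: "'a::metric_space set \<Rightarrow> real"
  assumes \<mu>: "finite_signed_measure \<mu>" and \<nu>: "finite_signed_measure \<nu>"
    and eq: "\<And>f. uniformly_continuous_on UNIV f \<Longrightarrow> bounded (range f) \<Longrightarrow>
      signed_integral \<nu> f = c * signed_integral \<mu> f"
    and A: "A \<in> sets borel"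
  shows "\<nu> A = c * \<mu> A"
proof -
  have closed: "\<nu> F = c * \<mu> F" if "closed F" for F
  \<comment> \<open>\<open>infdist x {}\<close> is 0 by convention, so for empty \<open>F\<close>
    the approximations below would be constantly 1.\<close>
  proof (cases "F = {}")
    case True
    then show ?thesis using \<mu> \<nu> by (simp add: finite_signed_measure_empty)
  next
    case False
    define f where "f n x = max 0 (1 - real n * infdist x F)" for n x
    have bd: "\<bar>f n x\<bar> \<le> 1" for n x
      by (simp add: f_def infdist_nonneg)
    have uc: "uniformly_continuous_on UNIV (f n)" for n
      unfolding uniformly_continuous_on_def
    proof (intro allI impI)
      fix e :: real assume "0 < e"
      show "\<exists>d>0. \<forall>x\<in>UNIV. \<forall>y\<in>UNIV. dist y x < d \<longrightarrow> dist (f n y) (f n x) < e"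
      \<comment> \<open>\<open>f n\<close> is Lipschitz with constant \<open>n\<close>; the
        denominator \<open>n + 1\<close> also covers \<open>n = 0\<close>.\<close>
      proof (intro exI[of _ "e / (real n + 1)"] conjI ballI impI)
        show "0 < e / (real n + 1)" using \<open>0 < e\<close> by simp
        fix x y :: 'a assume "dist y x < e / (real n + 1)"
        then have d: "(real n + 1) * dist y x < e"
          by (simp add: pos_less_divide_eq mult.commute)
        have "\<bar>real n * infdist y F - real n * infdist x F\<bar> \<le> real n * dist y x"
          using infdist_triangle_abs[of y F x] by (simp add: abs_mult flip: right_diff_distrib)
            (simp add: mult_left_mono)
        moreover have "\<bar>f n y - f n x\<bar> \<le> \<bar>real n * infdist y F - real n * infdist x F\<bar>"
          unfolding f_def by linarith
        moreover have "real n * dist y x \<le> (real n + 1) * dist y x"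
          by (simp add: mult_right_mono)
        ultimately show "dist (f n y) (f n x) < e"
          using d by (simp add: dist_real_def)
      qed
    qed
    have lim: "(\<lambda>n. f n x) \<longlonglongrightarrow> indicator F x" for x
    proof (cases "x \<in> F")
      case True
      then show ?thesis by (simp add: f_def)
    next
      case False
      then have pos: "0 < infdist x F"
        using \<open>closed F\<close> \<open>F \<noteq> {}\<close> by (simp add: infdist_pos_not_in_closed)
      obtain N where N: "1 / infdist x F < real N" using reals_Archimedean2 by blast
      have "f n x = 0" if "N \<le> n" for n
      proof -
        have "1 < real N * infdist x F" using N pos by (simp add: pos_divide_less_eq)
        also have "\<dots> \<le> real n * infdist x F" using that pos by (intro mult_right_mono) auto
        finally show ?thesis by (simp add: f_def)
      qed
      then have "(\<lambda>n. f n x) \<longlonglongrightarrow> 0"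
        by (intro tendsto_eventually) (auto simp: eventually_sequentially)
      then show ?thesis using False by simp
    qed
    have meas: "f n \<in> borel_measurable borel" for n
      using uc by (intro borel_measurable_continuous_onI uniformly_continuous_imp_continuous)
    have "signed_integral \<nu> (f n) = c * signed_integral \<mu> (f n)" for n
      using bd by (intro eq uc) (auto simp: bounded_iff)
    moreover have "(\<lambda>n. signed_integral \<nu> (f n)) \<longlonglongrightarrow> \<nu> F"
      using signed_integral_limit[OF \<nu> meas bd lim] signed_integral_indicator[OF \<nu>] \<open>closed F\<close> by simp
    moreover have "(\<lambda>n. c * signed_integral \<mu> (f n)) \<longlonglongrightarrow> c * \<mu> F"
      using signed_integral_limit[OF \<mu> meas bd lim] signed_integral_indicator[OF \<mu>] \<open>closed F\<close>
      by (intro tendsto_mult) simp_all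
    ultimately show ?thesis using LIMSEQ_unique by simp
  qed
  have sets_eq: "sets borel = sigma_sets UNIV (Collect closed :: 'a set set)"
    unfolding borel_eq_closed by (rule sets_measure_of) simp
  have "Int_stable (Collect closed :: 'a set set)"
    by (auto simp: Int_stable_def)
  moreover have "Collect closed \<subseteq> Pow (UNIV :: 'a set)" by simp
  moreover have "A \<in> sigma_sets UNIV (Collect closed)" using A sets_eq by simp
  ultimately show ?thesis
  proof (induction rule: sigma_sets_induct_disjoint)
    case (basic F)
    then show ?case using closed by simp
  next
    case empty
    then show ?case using closed by simp
  next
    case (compl B)
    then have "B \<in> sets borel" using sets_eq by simp
    then show ?case
      using finite_signed_measure_Diff[OF \<nu>, of UNIV B] finite_signed_measure_Diff[OF \<mu>, of UNIV B]
        compl(2) closed[of UNIV] by (simp add: right_diff_distrib)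
  next
    case (union B)
    then have "\<And>i. B i \<in> sets borel" using sets_eq by auto
    then have "(\<lambda>n. \<nu> (B n)) sums \<nu> (\<Union>n. B n)" "(\<lambda>n. c * \<mu> (B n)) sums (c * \<mu> (\<Union>n. B n))"
      using union(1) by (intro finite_signed_measure_sums[OF \<nu>] sums_mult finite_signed_measure_sums[OF \<mu>]; simp)+
    then show ?case using union(3) sums_unique2 by simp
  qed
qed

section \<open>Uniform boundedness\<close>

text \<open>The Banach-Steinhaus theorem. The closed sets \<open>E k\<close> exhaust the space, so
  by Baire's theorem one of them contains a ball, and linearity turns the bound on that ball into a
  bound on the operator norms.\<close>

lemma uniform_boundedness:
  fixes T :: "'i \<Rightarrow> 'a::{real_normed_vector, complete_space} \<Rightarrow> real"
  assumes T: "\<And>i. bounded_linear (T i)" and bdd: "\<And>x. \<exists>K. \<forall>i. \<bar>T i x\<bar> \<le> K"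
  shows "\<exists>K. \<forall>i x. \<bar>T i x\<bar> \<le> K * norm x"
proof -
  define E where "E k = {x. \<forall>i. \<bar>T i x\<bar> \<le> real k}" for k
  have closed: "closed (E k)" for k
    unfolding E_def using T
    by (intro closed_Collect_all closed_Collect_le continuous_on_rabs continuous_on_const
        linear_continuous_on)
  have cover: "(\<Union>k. E k) = UNIV"
  proof -
    have "\<exists>k. x \<in> E k" for x
    proof -
      obtain K where K: "\<And>i. \<bar>T i x\<bar> \<le> K" using bdd by blast
      obtain k where "K \<le> real k" using real_arch_simple by blast
      then have "x \<in> E k" unfolding E_def using K order_trans by blast
      then show ?thesis ..
    qed
    then show ?thesis by blast
  qed
  have "\<exists>k. interior (E k) \<noteq> {}"
  proof (rule ccontr)
    assume "\<nexists>k. interior (E k) \<noteq> {}"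
    then have "Met_TC.mtopology interior_of (\<Union>(range E)) = {}"
      using closed by (intro Met_TC.metric_Baire_category_alt) (auto simp: complete_UNIV)
    then show False unfolding cover by simp
  qed
  then obtain k x0 where "x0 \<in> interior (E k)" by blast
  then obtain r where r: "0 < r" "cball x0 r \<subseteq> E k"
    using mem_interior_cball by blast
  show ?thesis
  proof (intro exI[of _ "2 * real k / r"] allI)
    fix i x
    interpret bounded_linear "T i" by (rule T)
    show "\<bar>T i x\<bar> \<le> 2 * real k / r * norm x"
    proof (cases "x = 0")
      case False
      \<comment> \<open>Scaling \<open>x\<close> to length \<open>r\<close> keeps
        \<open>x0 + c *\<^sub>R x\<close> in the ball; subtracting the value at the centre costs the
        factor 2.\<close>
      define c where "c = r / norm x"
      have c: "0 < c" using r(1) False by (simp add: c_def)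
      have "norm (c *\<^sub>R x) = r" using c r(1) False by (simp add: c_def)
      then have "x0 + c *\<^sub>R x \<in> cball x0 r" "x0 \<in> cball x0 r"
        using r(1) by (simp_all add: dist_norm)
      then have "\<bar>T i (x0 + c *\<^sub>R x)\<bar> \<le> k" "\<bar>T i x0\<bar> \<le> k"
        using r(2) unfolding E_def by blast+
      then have "\<bar>c * T i x\<bar> \<le> 2 * real k"
        unfolding add scaleR real_scaleR_def by linarith
      then have "\<bar>T i x\<bar> \<le> 2 * real k / c"
        using c by (simp add: abs_mult pos_le_divide_eq mult.commute)
      then show ?thesis by (simp add: c_def)
    qed (simp add: zero)
  qed
qed

text \<open>Signed measures of fixed total mass can have unbounded variation, so the bound comes
  from Banach-Steinhaus on the space of bounded continuous functions, where weak convergence gives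
  pointwise boundedness.\<close>

lemma weakly_convergent_uniform_bound:
  fixes \<nu> :: "nat \<Rightarrow> 'a::metric_space set \<Rightarrow> real"
  assumes \<nu>: "\<And>n. finite_signed_measure (\<nu> n)" and weak: "weakly_converges \<nu> \<mu>"
  obtains C where "\<And>n f B. continuous_on UNIV f \<Longrightarrow> (\<And>x. \<bar>f x\<bar> \<le> B) \<Longrightarrow> \<bar>signed_integral (\<nu> n) f\<bar> \<le> B * C"
proof -
  define T where "T n \<phi> = signed_integral (\<nu> n) (apply_bcontfun \<phi>)" for n \<phi>
  have bb: "bounded_borel (apply_bcontfun \<phi>)" for \<phi> :: "'a \<Rightarrow>\<^sub>C real"
    using norm_bounded[of \<phi>]
    by (intro bounded_borelI[of _ "norm \<phi>"] borel_measurable_continuous_onI) auto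
  have "bounded_linear (T n)" for n
  proof -
    obtain C where C: "\<And>f B. f \<in> borel_measurable borel \<Longrightarrow> (\<And>x. \<bar>f x\<bar> \<le> B) \<Longrightarrow>
        \<bar>signed_integral (\<nu> n) f\<bar> \<le> B * C"
      using signed_integral_bound[OF \<nu>] by blast
    show ?thesis
    proof (rule bounded_linear_intro)
      show "T n (\<phi> + \<psi>) = T n \<phi> + T n \<psi>" for \<phi> \<psi>
        by (simp add: T_def signed_integral_add[OF \<nu> bb bb])
      show "T n (c *\<^sub>R \<phi>) = c *\<^sub>R T n \<phi>" for c \<phi>
        by (simp add: T_def signed_integral_cmult)
      show "norm (T n \<phi>) \<le> norm \<phi> * C" for \<phi>
        using C[OF bounded_borel_measurable[OF bb], of \<phi> "norm \<phi>"] norm_bounded[of \<phi>]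
        by (simp add: T_def)
    qed
  qed
  moreover have "\<exists>K. \<forall>n. \<bar>T n \<phi>\<bar> \<le> K" for \<phi>
  proof -
    have "bounded (range (apply_bcontfun \<phi>))"
      using norm_bounded[of \<phi>] by (auto simp: bounded_iff)
    then have "convergent (\<lambda>n. T n \<phi>)"
      using weak by (auto simp: T_def weakly_converges_def convergent_def)
    then have "Bseq (\<lambda>n. T n \<phi>)" by (rule convergent_imp_Bseq)
    then show ?thesis unfolding Bseq_def real_norm_def by blast
  qed
  ultimately have "\<exists>K. \<forall>n \<phi>. \<bar>T n \<phi>\<bar> \<le> K * norm \<phi>"
    by (rule uniform_boundedness)
  then obtain K where K: "\<And>n \<phi>. \<bar>T n \<phi>\<bar> \<le> K * norm \<phi>"
    by blast
  show thesis
  \<comment> \<open>The sign of \<open>K\<close> is unknown; with \<open>\<bar>K\<bar>\<close> the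
    norm of the function may be enlarged to \<open>B\<close>.\<close>
  proof (rule that[of "\<bar>K\<bar>"])
    fix n and f :: "'a \<Rightarrow> real" and B
    assume f: "continuous_on UNIV f" "\<And>x. \<bar>f x\<bar> \<le> B"
    then have app: "apply_bcontfun (Bcontfun f) = f"
      by (intro Bcontfun_inverse bcontfun_normI[of f B]) auto
    have "norm (Bcontfun f) \<le> B"
      using f(2) by (intro norm_bound) (simp add: app)
    then have "K * norm (Bcontfun f) \<le> B * \<bar>K\<bar>"
      by (simp add: mult.commute[of B] mult_mono)
    with K[of n "Bcontfun f"] show "\<bar>signed_integral (\<nu> n) f\<bar> \<le> B * \<bar>K\<bar>"
      by (simp add: T_def app)
  qed
qed

text \<open>Makes the inner integrals of the iterated equation integrable against a solution.
  Measurability comes from continuity in \<open>y\<close>, which dominated convergence gives along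
  sequences.\<close>

lemma bounded_borel_integral_translate:
  fixes f :: "'a::real_normed_field \<Rightarrow> real"
  assumes m: "finite_signed_measure m" and f: "continuous_on UNIV f" "bounded (range f)"
  shows "bounded_borel (\<lambda>y. signed_integral m (\<lambda>x. f (x + y / b)))"
proof -
  obtain B where B: "\<And>x. \<bar>f x\<bar> \<le> B" using f(2) by (auto simp: bounded_iff)
  obtain C where C: "\<And>f B. f \<in> borel_measurable borel \<Longrightarrow> (\<And>x. \<bar>f x\<bar> \<le> B) \<Longrightarrow>
      \<bar>signed_integral m f\<bar> \<le> B * C"
    using signed_integral_bound[OF m] by blast
  have meas: "(\<lambda>x. f (x + y)) \<in> borel_measurable borel" for y
    by (intro borel_measurable_continuous_onI continuous_intros
        continuous_on_compose2[OF f(1)]) auto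
  show ?thesis
  proof (rule bounded_borelI)
    show "\<bar>signed_integral m (\<lambda>x. f (x + y / b))\<bar> \<le> B * C" for y
      using meas B by (rule C)
    have "continuous_on UNIV (\<lambda>y. signed_integral m (\<lambda>x. f (x + y / b)))"
    proof (rule continuous_on_sequentiallyI)
      fix u and y :: 'a assume "u \<longlonglongrightarrow> y"
      then have "(\<lambda>n. x + u n / b) \<longlonglongrightarrow> x + y / b" for x
        unfolding divide_inverse by (intro tendsto_intros)
      then have "(\<lambda>n. f (x + u n / b)) \<longlonglongrightarrow> f (x + y / b)" for x
        by (rule continuous_on_tendsto_compose[OF f(1)]) auto
      then show "(\<lambda>n. signed_integral m (\<lambda>x. f (x + u n / b)))
          \<longlonglongrightarrow> signed_integral m (\<lambda>x. f (x + y / b))"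
        using meas B by (intro signed_integral_limit[OF m])
    qed
    then show "(\<lambda>y. signed_integral m (\<lambda>x. f (x + y / b))) \<in> borel_measurable borel"
      by (rule borel_measurable_continuous_onI)
  qed
qed

section \<open>Dilation equations\<close>

text \<open>Both cases are multiplication by a field element of norm greater than 1, so they are
  treated together.\<close>

locale dilation =
  fixes a :: "'a::real_normed_field" and \<Gamma> :: "'a set" and p :: "'a \<Rightarrow> real"
  assumes expanding: "1 < norm a"
begin

abbreviation "S \<equiv> coeff_support \<Gamma> p"
abbreviation "M \<equiv> (\<lambda>x. a * x)"
abbreviation "\<mu> \<equiv> dilation_measure \<Gamma> M p"
abbreviation "h k y \<equiv> (y + k) / a"

lemma a_nonzero: "a \<noteq> 0"
  using expanding by auto

lemma inv_M: "inv M = (\<lambda>y. y / a)"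
  using a_nonzero by (intro inv_equality) auto

text \<open>\<open>h k\<close> inverts \<open>x \<mapsto> a * x - k\<close>. With preimages, the
  right-hand side of the dilation equation becomes a combination of push-forwards.\<close>

lemma image_M: "(\<lambda>x. a * x - k) ` A = h k -` A"
proof -
  have "y = a * h k y - k" for y using a_nonzero by simp
  then have "y \<in> (\<lambda>x. a * x - k) ` A" if "h k y \<in> A" for y
    using that by (metis (no_types, lifting) imageI)
  then show ?thesis using a_nonzero by auto
qed

lemma continuous_h: "continuous_on UNIV (h k)"
  by (intro continuous_intros) (simp add: a_nonzero)

lemma measurable_h: "h k \<in> borel_measurable borel"
  by (rule borel_measurable_continuous_onI[OF continuous_h])

lemma solves_dilation_equation_iff:
  "solves_dilation_equation \<Gamma> M p \<nu> \<longleftrightarrow> (\<forall>A\<in>sets borel. \<nu> A = (\<Sum>k\<in>S. p k * \<nu> (h k -` A)))"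
  by (simp add: solves_dilation_equation_def image_M)

text \<open>Each point mass is seen as the push-forward of the one at 0 under a constant map, so
  that the results on combinations of push-forwards apply.\<close>

lemma first_measure_eq: "first_measure \<Gamma> M p A = (\<Sum>k\<in>S. p k * point_mass 0 ((\<lambda>x :: 'a. k / a) -` A))"
  by (auto simp: first_measure_def inv_M point_mass_def indicator_def intro!: sum.cong)

lemma finite_signed_measure_first: "finite_signed_measure (first_measure \<Gamma> M p)"
  unfolding first_measure_eq[abs_def]
  by (intro finite_signed_measure_lincomb_push_forward finite_signed_measure_point_mass) simp

lemma signed_integral_first:
  assumes "bounded_borel f"
  shows "signed_integral (first_measure \<Gamma> M p) f = (\<Sum>k\<in>S. p k * f (k / a))"
proof -
  have "signed_integral (first_measure \<Gamma> M p) f =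
      (\<Sum>k\<in>S. p k * signed_integral (point_mass (0 :: 'a)) (\<lambda>x. f (k / a)))"
    using assms
    by (intro signed_integral_lincomb_push_forward finite_signed_measure_first
        finite_signed_measure_point_mass first_measure_eq) auto
  then show ?thesis
    by (simp add: signed_integral_const[OF finite_signed_measure_point_mass] point_mass_def)
qed

lemma affine_preimage_borel:
  fixes A :: "'a set"
  assumes "A \<in> sets borel"
  shows "{y. x + c * y \<in> A} \<in> sets borel"
proof -
  have "(\<lambda>y. x + c * y) \<in> borel_measurable borel"
    by (intro borel_measurable_continuous_onI continuous_intros)
  from measurable_sets[OF this assms] show ?thesis by (simp add: vimage_def)
qed

text \<open>The convolution integrates \<open>x \<mapsto> \<mu> {y. x + y / a \<in> A}\<close> against the first measure, which is
  only meaningful because this function is Borel measurable.\<close>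

lemma dilation_measure_Suc_aux:
  assumes fin: "finite_signed_measure (\<mu> n)"
    and meas: "\<And>A c. A \<in> sets borel \<Longrightarrow> (\<lambda>x. \<mu> n {y. x + c * y \<in> A}) \<in> borel_measurable borel"
    and A: "A \<in> sets borel"
  shows "\<mu> (Suc n) A = (\<Sum>k\<in>S. p k * \<mu> n (h k -` A))"
proof -
  obtain K where K: "\<And>A. A \<in> sets borel \<Longrightarrow> \<bar>\<mu> n A\<bar> \<le> K"
    using finite_signed_measure_bounded[OF fin] by blast
  have "bounded_borel (\<lambda>x. \<mu> n {y. x + (1 / a) * y \<in> A})"
    using meas[OF A] K[OF affine_preimage_borel[OF A]] by (rule bounded_borelI)
  from signed_integral_first[OF this] show ?thesis
    by (simp add: signed_convolution_def push_forward_def inv_M vimage_def add_divide_distrib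
        add.commute)
qed

text \<open>The claims are proved together because measurability at stage \<open>n\<close> is what
  allows the convolution at stage \<open>n + 1\<close> to be evaluated. The factor \<open>c\<close>
  is arbitrary since the induction step replaces it by \<open>c / a\<close>.\<close>

lemma dilation_measure_regular:
  "finite_signed_measure (\<mu> n) \<and>
    (\<forall>A\<in>sets borel. \<forall>c. (\<lambda>x. \<mu> n {y. x + c * y \<in> A}) \<in> borel_measurable borel)"
proof (induction n)
  case 0
  have "(\<lambda>x. \<mu> 0 {y. x + c * y \<in> A}) \<in> borel_measurable borel" if A: "A \<in> sets borel" for A c
  proof -
    have "(\<lambda>x. indicator A (x + c * (k / a)) :: real) \<in> borel_measurable borel" for k
      by (intro measurable_compose[OF _ borel_measurable_indicator[OF A]]
          borel_measurable_continuous_onI continuous_intros)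
    then have "(\<lambda>x. \<Sum>k\<in>S. p k * indicator A (x + c * (k / a))) \<in> borel_measurable borel"
      by (intro borel_measurable_sum borel_measurable_times borel_measurable_const)
    then show ?thesis
      by (simp add: first_measure_def inv_M point_mass_def indicator_def)
  qed
  then show ?case by (simp add: finite_signed_measure_first)
next
  case (Suc n)
  then have fin: "finite_signed_measure (\<mu> n)"
    and meas: "\<And>A c. A \<in> sets borel \<Longrightarrow> (\<lambda>x. \<mu> n {y. x + c * y \<in> A}) \<in> borel_measurable borel"
    by auto
  have step: "\<mu> (Suc n) A = (\<Sum>k\<in>S. p k * \<mu> n (h k -` A))" if "A \<in> sets borel" for A
    using fin meas that by (rule dilation_measure_Suc_aux)
  have "finite_signed_measure (\<mu> (Suc n))"
    using finite_signed_measure_lincomb_push_forward[OF fin measurable_h] step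
    by (rule finite_signed_measure_cong)
  moreover have "(\<lambda>x. \<mu> (Suc n) {y. x + c * y \<in> A}) \<in> borel_measurable borel"
    if A: "A \<in> sets borel" for A c
  proof -
    have "(\<lambda>x. \<mu> n {y. (x + c * k / a) + (c / a) * y \<in> A}) \<in> borel_measurable borel" for k
      by (intro measurable_compose[OF _ meas[OF A]] borel_measurable_continuous_onI
          continuous_intros)
    moreover have "h k -` {y. x + c * y \<in> A} = {y. (x + c * k / a) + (c / a) * y \<in> A}" for k x
      by (simp add: vimage_def add_divide_distrib distrib_left ac_simps)
    ultimately show ?thesis
      unfolding step[OF affine_preimage_borel[OF A]]
      by (intro borel_measurable_sum borel_measurable_times borel_measurable_const) simp
  qed
  ultimately show ?case by blast
qed

lemmas finite_signed_measure_dilation = dilation_measure_regular[THEN conjunct1]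

lemma dilation_measure_Suc:
  "A \<in> sets borel \<Longrightarrow> \<mu> (Suc n) A = (\<Sum>k\<in>S. p k * \<mu> n (h k -` A))"
  using dilation_measure_regular[of n] by (intro dilation_measure_Suc_aux) auto

declare dilation_measure.simps(2) [simp del]

section \<open>Integrals against the dilation measures and against solutions\<close>

lemma signed_integral_dilation_Suc:
  "bounded_borel f \<Longrightarrow>
    signed_integral (\<mu> (Suc n)) f = (\<Sum>k\<in>S. p k * signed_integral (\<mu> n) (\<lambda>x. f (h k x)))"
  by (intro signed_integral_lincomb_push_forward finite_signed_measure_dilation measurable_h
      dilation_measure_Suc)

lemma signed_integral_solution:
  "finite_signed_measure \<nu> \<Longrightarrow> solves_dilation_equation \<Gamma> M p \<nu> \<Longrightarrow> bounded_borel f \<Longrightarrow>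
    signed_integral \<nu> f = (\<Sum>k\<in>S. p k * signed_integral \<nu> (\<lambda>x. f (h k x)))"
  by (intro signed_integral_lincomb_push_forward measurable_h)
    (simp_all add: solves_dilation_equation_iff)

lemma continuous_compose_h: "continuous_on UNIV f \<Longrightarrow> continuous_on UNIV (\<lambda>x. f (h k x))"
  using continuous_on_compose2[OF _ continuous_h] by blast

lemma bounded_compose_h: "bounded (range f) \<Longrightarrow> bounded (range (\<lambda>x. f (h k x)))"
  by (rule bounded_subset) auto

text \<open>The right-hand side of the dilation equation is weakly continuous, because
  \<open>f\<close> composed with \<open>h k\<close> is again bounded and continuous. The shifted
  sequence therefore converges to both \<nu>' and \<nu>.\<close>

lemma weak_limit_solves:
  assumes \<nu>: "finite_signed_measure \<nu>" and weak: "weakly_converges \<mu> \<nu>"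
  shows "solves_dilation_equation \<Gamma> M p \<nu>"
proof -
  define \<nu>' where "\<nu>' A = (\<Sum>k\<in>S. p k * \<nu> (h k -` A))" for A
  have \<nu>': "finite_signed_measure \<nu>'"
    using finite_signed_measure_lincomb_push_forward[OF \<nu> measurable_h] \<nu>'_def
    by (rule finite_signed_measure_cong)
  have "\<nu>' A = 1 * \<nu> A" if "A \<in> sets borel" for A
  proof (rule finite_signed_measure_eqI[OF \<nu> \<nu>' _ that])
    fix f :: "'a \<Rightarrow> real"
    assume "uniformly_continuous_on UNIV f" and bd: "bounded (range f)"
    then have cont: "continuous_on UNIV f" by (simp add: uniformly_continuous_imp_continuous)
    note bb = bounded_borel_continuous[OF cont bd]
    have "(\<lambda>n. \<Sum>k\<in>S. p k * signed_integral (\<mu> n) (\<lambda>x. f (h k x)))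
        \<longlonglongrightarrow> (\<Sum>k\<in>S. p k * signed_integral \<nu> (\<lambda>x. f (h k x)))"
      using weak continuous_compose_h[OF cont] bounded_compose_h[OF bd]
      unfolding weakly_converges_def
      by (intro tendsto_sum tendsto_mult tendsto_const) blast
    moreover have "(\<Sum>k\<in>S. p k * signed_integral \<nu> (\<lambda>x. f (h k x))) = signed_integral \<nu>' f"
      using signed_integral_lincomb_push_forward[OF \<nu> \<nu>' measurable_h \<nu>'_def bb] by simp
    ultimately have "(\<lambda>n. signed_integral (\<mu> (Suc n)) f) \<longlonglongrightarrow> signed_integral \<nu>' f"
      using signed_integral_dilation_Suc[OF bb] by simp
    moreover have "(\<lambda>n. signed_integral (\<mu> (Suc n)) f) \<longlonglongrightarrow> signed_integral \<nu> f"
      using weak cont bd unfolding weakly_converges_def by (intro LIMSEQ_Suc) blast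
    ultimately show "signed_integral \<nu>' f = 1 * signed_integral \<nu> f"
      using LIMSEQ_unique by simp
  qed
  then show ?thesis by (simp add: solves_dilation_equation_iff \<nu>'_def)
qed

text \<open>The iterated equation in integral form; \<open>\<mu> n\<close> is the measure with
  number n + 1, hence the exponent \<open>Suc n\<close>. In the induction the dilation equation is
  applied to \<open>f\<close> and the hypothesis to \<open>f\<close> composed with
  \<open>h k\<close>.\<close>

lemma signed_integral_solution_iterate:
  assumes \<nu>: "finite_signed_measure \<nu>" and sol: "solves_dilation_equation \<Gamma> M p \<nu>"
    and f: "continuous_on UNIV f" "bounded (range f)"
  shows "signed_integral \<nu> f =
    signed_integral \<nu> (\<lambda>y. signed_integral (\<mu> n) (\<lambda>x. f (x + y / a ^ Suc n)))"
  using f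
proof (induction n arbitrary: f)
  case (0 f)
  have bb: "bounded_borel (\<lambda>x. f (x + y))" for y
    using bounded_borel_continuous[OF 0]
    by (rule bounded_borel_compose)
      (intro borel_measurable_continuous_onI continuous_intros)
  have "signed_integral (\<mu> 0) (\<lambda>x. f (x + y / a)) = (\<Sum>k\<in>S. p k * f (h k y))" for y
    using signed_integral_first[OF bb] by (simp add: add_divide_distrib add.commute[of y])
  then show ?case
    using signed_integral_solution[OF \<nu> sol bounded_borel_continuous[OF 0]]
      bounded_borel_compose[OF bounded_borel_continuous[OF 0] measurable_h]
    by (simp add: signed_integral_sum \<nu> bounded_borel_cmult signed_integral_cmult)
next
  case (Suc n f)
  have bb: "bounded_borel (\<lambda>x. f (x + y))" for y
    using bounded_borel_continuous[OF Suc.prems]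
    by (rule bounded_borel_compose)
      (intro borel_measurable_continuous_onI continuous_intros)
  let ?g = "\<lambda>k y. signed_integral (\<mu> n) (\<lambda>x. f (h k (x + y / a ^ Suc n)))"
  note fh = continuous_compose_h[OF Suc.prems(1)] bounded_compose_h[OF Suc.prems(2)]
  \<comment> \<open>A translation by \<open>y / a ^ Suc (Suc n)\<close> after \<open>h k\<close> is
    a translation by \<open>y / a ^ Suc n\<close> before it.\<close>
  have "h k x + y / a ^ Suc (Suc n) = h k (x + y / a ^ Suc n)" for k x y
    by (simp add: add_divide_distrib ac_simps)
  then have "signed_integral (\<mu> (Suc n)) (\<lambda>x. f (x + y / a ^ Suc (Suc n))) = (\<Sum>k\<in>S. p k * ?g k y)" for y
    using signed_integral_dilation_Suc[OF bb] by simp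
  moreover have "bounded_borel (?g k)" for k
    using bounded_borel_integral_translate[OF finite_signed_measure_dilation fh] .
  ultimately show ?case
    using signed_integral_solution[OF \<nu> sol bounded_borel_continuous[OF Suc.prems]] Suc.IH[OF fh]
    by (simp add: signed_integral_sum \<nu> bounded_borel_cmult signed_integral_cmult)
qed

text \<open>In the limit the inner integrals no longer depend on \<open>y\<close>, so only the total
  mass of \<tau> survives as the factor. Uniform continuity of \<open>f\<close> controls the
  translation uniformly in \<open>x\<close> while \<open>\<mu> n\<close> varies.\<close>

lemma solution_unique:
  assumes \<nu>: "finite_signed_measure \<nu>" and weak: "weakly_converges \<mu> \<nu>"
    and \<tau>: "finite_signed_measure \<tau>" and sol: "solves_dilation_equation \<Gamma> M p \<tau>"
    and A: "A \<in> sets borel"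
  shows "\<tau> A = \<tau> UNIV * \<nu> A"
proof (rule finite_signed_measure_eqI[OF \<nu> \<tau> _ A])
  fix f :: "'a \<Rightarrow> real"
  assume uc: "uniformly_continuous_on UNIV f" and bd: "bounded (range f)"
  then have cont: "continuous_on UNIV f" by (simp add: uniformly_continuous_imp_continuous)
  note bb = bounded_borel_continuous[OF cont bd]
  obtain B where B: "\<And>x. \<bar>f x\<bar> \<le> B" using bd by (auto simp: bounded_iff)
  obtain C where C: "\<And>n f B. continuous_on UNIV f \<Longrightarrow> (\<And>x. \<bar>f x\<bar> \<le> B) \<Longrightarrow>
      \<bar>signed_integral (\<mu> n) f\<bar> \<le> B * C"
    using weakly_convergent_uniform_bound[OF finite_signed_measure_dilation weak] by blast
  have tr: "continuous_on UNIV (\<lambda>x. f (x + y))" for y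
    by (intro continuous_on_compose2[OF cont] continuous_intros) auto
  define g where "g n y = signed_integral (\<mu> n) (\<lambda>x. f (x + y / a ^ Suc n))" for n y
  have "(\<lambda>n. g n y) \<longlonglongrightarrow> signed_integral \<nu> f" for y
  proof -
    have "(\<lambda>n. g n y - signed_integral (\<mu> n) f) \<longlonglongrightarrow> 0"
    proof (rule LIMSEQ_I)
      fix r :: real assume "0 < r"
      \<comment> \<open>Chosen so that \<open>e * \<bar>C\<bar> < r\<close>, whatever the sign of
        \<open>C\<close> and also for \<open>C = 0\<close>.\<close>
      define e where "e = r / (\<bar>C\<bar> + 1)"
      have e: "0 < e" using \<open>0 < r\<close> by (simp add: e_def)
      obtain d where d: "0 < d" "\<And>x x'. dist x' x < d \<Longrightarrow> dist (f x') (f x) < e"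
        using uc e unfolding uniformly_continuous_on_def by blast
      \<comment> \<open>Expansion enters here: the powers of \<open>1 / a\<close> tend to 0.\<close>
      have "(\<lambda>n. y * (1 / a) ^ Suc n) \<longlonglongrightarrow> y * 0"
        using expanding a_nonzero
        by (intro tendsto_mult tendsto_const LIMSEQ_Suc LIMSEQ_power_zero)
          (simp add: norm_divide)
      then obtain N where N: "\<And>n. N \<le> n \<Longrightarrow> norm (y / a ^ Suc n) < d"
        using LIMSEQ_D[of _ "y * 0" d] d(1) by (auto simp: power_one_over divide_inverse power_inverse)
      have "norm (g n y - signed_integral (\<mu> n) f - 0) < r" if "N \<le> n" for n
      proof -
        have "\<bar>f (x + y / a ^ Suc n) - f x\<bar> \<le> e" for x
          using d(2)[of "x + y / a ^ Suc n" x] N[OF that] by (simp add: dist_norm)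
        \<comment> \<open>\<open>C\<close> does not depend on \<open>n\<close>, so a difference that
          is uniformly small has a small integral against every \<open>\<mu> n\<close>.\<close>
        then have "\<bar>signed_integral (\<mu> n) (\<lambda>x. f (x + y / a ^ Suc n) - f x)\<bar> \<le> e * C"
          using tr cont by (intro C continuous_on_diff)
        also have "\<dots> \<le> e * \<bar>C\<bar>" using e by simp
        also have "\<dots> < e * (\<bar>C\<bar> + 1)" using e by simp
        also have "\<dots> = r" by (simp add: e_def)
        also have "signed_integral (\<mu> n) (\<lambda>x. f (x + y / a ^ Suc n) - f x) =
            g n y - signed_integral (\<mu> n) f"
          unfolding g_def
          using bb bounded_borelI[OF borel_measurable_continuous_onI[OF tr] B]
          by (intro signed_integral_diff finite_signed_measure_dilation)
        finally show ?thesis by simp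
      qed
      then show "\<exists>N. \<forall>n\<ge>N. norm (g n y - signed_integral (\<mu> n) f - 0) < r" by blast
    qed
    moreover have "(\<lambda>n. signed_integral (\<mu> n) f) \<longlonglongrightarrow> signed_integral \<nu> f"
      using weak cont bd by (simp add: weakly_converges_def)
    ultimately show ?thesis by (rule Lim_transform[rotated])
  qed
  moreover have "g n \<in> borel_measurable borel" for n
    unfolding g_def[abs_def]
    using bounded_borel_integral_translate[OF finite_signed_measure_dilation cont bd]
    by (rule bounded_borel_measurable)
  moreover have "\<bar>g n y\<bar> \<le> B * C" for n y
    unfolding g_def using tr B by (rule C)
  ultimately have "(\<lambda>n. signed_integral \<tau> (g n)) \<longlonglongrightarrow> signed_integral \<tau> (\<lambda>y. signed_integral \<nu> f)"
    by (intro signed_integral_limit[OF \<tau>])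
  \<comment> \<open>By the iterated equation the sequence of integrals is constant, so its limit is
    the integral of \<open>f\<close> itself.\<close>
  moreover have "signed_integral \<tau> (g n) = signed_integral \<tau> f" for n
    using signed_integral_solution_iterate[OF \<tau> sol cont bd] by (simp add: g_def[abs_def])
  ultimately have "signed_integral \<tau> f = signed_integral \<nu> f * \<tau> UNIV"
    by (simp add: signed_integral_const[OF \<tau>] LIMSEQ_const_iff)
  then show "signed_integral \<tau> f = \<tau> UNIV * signed_integral \<nu> f" by simp
qed

end

section \<open>Specialisation to the real and the complex case\<close>

theorem theorem5:
  shows
    "(\<forall>(p :: real \<Rightarrow> real) (\<mu> :: real set \<Rightarrow> real).
        dilation_coeffs \<int> p \<longrightarrow>
        finite_signed_measure \<mu> \<longrightarrow>
        weakly_converges (dilation_measure \<int> (\<lambda>x. 2 * x) p) \<mu> \<longrightarrow>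
        solves_dilation_equation \<int> (\<lambda>x. 2 * x) p \<mu> \<and>
        (\<forall>\<nu>. finite_signed_measure \<nu> \<longrightarrow> solves_dilation_equation \<int> (\<lambda>x. 2 * x) p \<nu> \<longrightarrow>
          (\<exists>c::real. \<forall>A \<in> sets borel. \<nu> A = c * \<mu> A)))
     \<and>
     (\<forall>(p :: complex \<Rightarrow> real) (\<mu> :: complex set \<Rightarrow> real).
        dilation_coeffs gaussian_integers p \<longrightarrow>
        finite_signed_measure \<mu> \<longrightarrow>
        weakly_converges (dilation_measure gaussian_integers (\<lambda>z. (1 + \<i>) * z) p) \<mu> \<longrightarrow>
        solves_dilation_equation gaussian_integers (\<lambda>z. (1 + \<i>) * z) p \<mu> \<and>
        (\<forall>\<nu>. finite_signed_measure \<nu> \<longrightarrow>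
          solves_dilation_equation gaussian_integers (\<lambda>z. (1 + \<i>) * z) p \<nu> \<longrightarrow>
          (\<exists>c::real. \<forall>A \<in> sets borel. \<nu> A = c * \<mu> A)))"
proof -
  interpret R: dilation "2 :: real" \<int> p for p
    by unfold_locales simp
  interpret C: dilation "1 + \<i>" gaussian_integers p for p
    by unfold_locales (simp add: cmod_def)
  show ?thesis
    \<comment> \<open>The constant left open by \<open>exI\<close> is fixed by unification with
      \<open>solution_unique\<close>: it is the total mass of the given solution.\<close>
    by (intro conjI allI impI exI ballI)
      (erule R.weak_limit_solves C.weak_limit_solves R.solution_unique C.solution_unique; assumption)+
qed

end
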